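(* Consider a Fisher market instance with finite agent set $\mathcal{A}$, finite goods set $\mathcal{M}$, budgets $b_i>0$ and utility functions $u_i$, $i\in\mathcal{A}$, where every $u_i$ is $\Sigma$-Gale-substitutes. Then, for any competitive equilibrium $((\mathbf{x}_i)_{i\in\mathcal{A}},\mathbf{p})$ and any Nash welfare maximizing allocation $(\mathbf{y}_i)_{i\in\mathcal{A}}$, we have $u_i(\mathbf{y}_i)\ge\frac12u_i(\mathbf{x}_i)$ for every $i\in\mathcal{A}$.
   Context: Utility function: a function $u:\mathbb{R}_{\ge 0}^{\mathcal{M}}\to\mathbb{R}_{\ge 0}$ with $u(\mathbf{0})=0$ that is concave, continuous, monotone non-decreasing, and satisfies $u(\mathbf{x})>0$ for some $\mathbf{x}$. Fisher market instance: a finite set $\mathcal{A}$ of agents, a finite set $\mathcal{M}$ of divisible goods with one unit of each good available, and for each agent $i$ a utility function $u_i$ and a budget $b_i>0$. An allocation is $(\mathbf{x}_i)_{i\in\mathcal{A}}$ with $\mathbf{x}_i\in\mathbb{R}_{\ge 0}^{\mathcal{M}}$. Prices are $\mathbf{p}\in\mathbb{R}_{\ge0}^{\mathcal{M}}$. Competitive equilibrium: $((\mathbf{x}_i)_{i\in\mathcal{A}},\mathbf{p})$ such that (i) for every $i$, $\mathbf{x}_i$ maximizes $u_i(\mathbf{z})$ over $\{\mathbf{z}\in\mathbb{R}_{\ge 0}^{\mathcal{M}}:\langle\mathbf{p},\mathbf{z}\rangle\le b_i\}$; (ii) $\sum_i x_{ij}\le 1$ for all $j$; (iii) $\sum_i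 x_{ij}=1$ whenever $p_j>0$. Nash welfare of $(\mathbf{y}_i)$: $\left(\prod_{i} u_i(\mathbf{y}_i)^{b_i}\right)^{1/\sum_i b_i}$. A Nash welfare maximizing allocation attains the highest Nash welfare among all allocations with $\sum_i y_{ij}\le 1$ for all $j$. Gale demand: for a utility function $u$, $\mathbf{q}\in\mathbb{R}_{\ge0}^{\mathcal{M}}$, $b>0$, $\mathcal{GD}^u(\mathbf{q},b)=\arg\max_{\mathbf{y}\in\mathbb{R}_{\ge0}^{\mathcal{M}}}\ b\log u(\mathbf{y})-\langle\mathbf{q},\mathbf{y}\rangle$ (with $\log0=-\infty$). Its price domain is $\operatorname{pdom}(u)=\{\mathbf{q}\in\mathbb{R}_{\ge0}^{\mathcal{M}}:\exists b>0,\ \sup_{\mathbf{y}\in\mathbb{R}_{\ge0}^{\mathcal{M}}} b\log u(\mathbf{y})-\langle\mathbf{q},\mathbf{y}\rangle<+\infty\}$. $u$ is Gale-substitutes if: (i) for any $b>0$, $\mathbf{q},\mathbf{q}'\in\operatorname{pdom}(u)$ with $\mathbf{q}\ge\mathbf{q}'$ and $\mathbf{y}\in\mathcal{GD}^u(\mathbf{q},b)$, there exists $\mathbf{y}'\in\mathcal{GD}^u(\mathbf{q}',b)$ such that $y'_j\le y_j$ whenever $q'_j=q_j$; and (ii) for any $b\ge b'>0$, $\mathbf{q}\in\operatorname{pdom}(u)$ and $\mathbf{y}\in\mathcal{GD}^u(\mathbf{q},b)$, there exists $\mathbf{y}'\in\mathcal{GD}^u(\mathbf{q},b')$ with $\mathbf{y}'\le\mathbf{y}$.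 $u$ is $\Sigma$-Gale-substitutes if it is Gale-substitutes and moreover: if $\mathbf{0}\in\operatorname{pdom}(u)$, $b>0$ and $\mathbf{q}\in\mathbb{R}_{\ge0}^{\mathcal{M}}$, then for any $\mathbf{y}\in\mathcal{GD}^u(\mathbf{0},b)$ there exists $\mathbf{y}'\in\mathcal{GD}^u(\mathbf{q},b)$ with $\mathbf{y}'\le\mathbf{y}$. *)

theory Defs
  imports "HOL-Analysis.Analysis"
begin

text \<open>
  Goods are the elements of a finite index type \<open>'m\<close>, so bundles and prices are vectors in
  \<open>real ^ 'm\<close>, whose library order is componentwise and whose library inner product is the usual
  \<open>\<Sum>j. p $ j * x $ j\<close>. Agents form a finite set \<open>A\<close>; the values of budgets, utilities and
  allocations outside \<open>A\<close> are irrelevant, as are the values of utilities outside the orthant.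
\<close>

definition orthant :: "(real ^ 'm::finite) set" where
  "orthant = {x. 0 \<le> x}"

definition utility_function :: "(real ^ 'm::finite \<Rightarrow> real) \<Rightarrow> bool" where
  "utility_function u \<longleftrightarrow>
     (\<forall>x\<in>orthant. 0 \<le> u x) \<and> u 0 = 0 \<and>
     concave_on orthant u \<and> continuous_on orthant u \<and> mono_on orthant u \<and>
     (\<exists>x\<in>orthant. 0 < u x)"

definition fisher_market ::
  "'a set \<Rightarrow> ('a \<Rightarrow> real) \<Rightarrow> ('a \<Rightarrow> real ^ 'm::finite \<Rightarrow> real) \<Rightarrow> bool" where
  "fisher_market A b u \<longleftrightarrow> finite A \<and> (\<forall>i\<in>A. 0 < b i \<and> utility_function (u i))"

definition feasible_allocation :: "'a set \<Rightarrow> ('a \<Rightarrow> real ^ 'm::finite) \<Rightarrow> bool" where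
  "feasible_allocation A x \<longleftrightarrow>
     (\<forall>i\<in>A. x i \<in> orthant) \<and> (\<forall>j. (\<Sum>i\<in>A. x i $ j) \<le> 1)"

definition competitive_equilibrium ::
  "'a set \<Rightarrow> ('a \<Rightarrow> real) \<Rightarrow> ('a \<Rightarrow> real ^ 'm::finite \<Rightarrow> real) \<Rightarrow>
   ('a \<Rightarrow> real ^ 'm) \<Rightarrow> real ^ 'm \<Rightarrow> bool" where
  "competitive_equilibrium A b u x p \<longleftrightarrow>
     p \<in> orthant \<and>
     (\<forall>i\<in>A. is_arg_max (u i) (\<lambda>z. z \<in> orthant \<and> p \<bullet> z \<le> b i) (x i)) \<and>
     feasible_allocation A x \<and>
     (\<forall>j. 0 < p $ j \<longrightarrow> (\<Sum>i\<in>A. x i $ j) = 1)"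

definition nash_welfare ::
  "'a set \<Rightarrow> ('a \<Rightarrow> real) \<Rightarrow> ('a \<Rightarrow> real ^ 'm::finite \<Rightarrow> real) \<Rightarrow>
   ('a \<Rightarrow> real ^ 'm) \<Rightarrow> real" where
  "nash_welfare A b u y = (\<Prod>i\<in>A. u i (y i) powr b i) powr (1 / (\<Sum>i\<in>A. b i))"

definition nash_welfare_maximizing ::
  "'a set \<Rightarrow> ('a \<Rightarrow> real) \<Rightarrow> ('a \<Rightarrow> real ^ 'm::finite \<Rightarrow> real) \<Rightarrow>
   ('a \<Rightarrow> real ^ 'm) \<Rightarrow> bool" where
  "nash_welfare_maximizing A b u y \<longleftrightarrow>
     is_arg_max (nash_welfare A b u) (feasible_allocation A) y"

text \<open>The library has \<open>ln 0 = 0\<close>; here the convention is \<open>log 0 = - \<infinity>\<close>.\<close>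

definition elog :: "real \<Rightarrow> ereal" where
  "elog t = (if 0 < t then ereal (ln t) else - \<infinity>)"

definition gale_objective ::
  "(real ^ 'm::finite \<Rightarrow> real) \<Rightarrow> real ^ 'm \<Rightarrow> real \<Rightarrow> real ^ 'm \<Rightarrow> ereal" where
  "gale_objective u q b y = ereal b * elog (u y) - ereal (q \<bullet> y)"

definition gale_demand ::
  "(real ^ 'm::finite \<Rightarrow> real) \<Rightarrow> real ^ 'm \<Rightarrow> real \<Rightarrow> (real ^ 'm) set" where
  "gale_demand u q b = {y. is_arg_max (gale_objective u q b) (\<lambda>z. z \<in> orthant) y}"

definition pdom :: "(real ^ 'm::finite \<Rightarrow> real) \<Rightarrow> (real ^ 'm) set" where
  "pdom u = {q \<in> orthant. \<exists>b>0. (SUP y\<in>orthant. gale_objective u q b y) < \<infinity>}"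

definition gale_substitutes :: "(real ^ 'm::finite \<Rightarrow> real) \<Rightarrow> bool" where
  "gale_substitutes u \<longleftrightarrow>
     (\<forall>b>0. \<forall>q\<in>pdom u. \<forall>q'\<in>pdom u. q' \<le> q \<longrightarrow>
        (\<forall>y\<in>gale_demand u q b. \<exists>y'\<in>gale_demand u q' b.
           \<forall>j. q' $ j = q $ j \<longrightarrow> y' $ j \<le> y $ j)) \<and>
     (\<forall>b b'. 0 < b' \<and> b' \<le> b \<longrightarrow>
        (\<forall>q\<in>pdom u. \<forall>y\<in>gale_demand u q b. \<exists>y'\<in>gale_demand u q b'. y' \<le> y))"

definition sigma_gale_substitutes :: "(real ^ 'm::finite \<Rightarrow> real) \<Rightarrow> bool" where
  "sigma_gale_substitutes u \<longleftrightarrow>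
     gale_substitutes u \<and>
     (0 \<in> pdom u \<longrightarrow>
        (\<forall>b>0. \<forall>q\<in>orthant. \<forall>y\<in>gale_demand u 0 b. \<exists>y'\<in>gale_demand u q b. y' \<le> y))"

end

theory Submission
  imports Defs
begin

text \<open>
  A Nash welfare maximizer \<open>y\<close> has supporting prices \<open>q\<close> (Lagrange multipliers) at which every
  \<open>y i\<close> is a Gale demand. If \<open>q\<close> can be chosen with \<open>q \<le> p\<close>, then the supergradient form of
  optimality gives \<open>u (x i) \<le> u (y i) * (1 + q \<bullet> x i / b i) \<le> 2 * u (y i)\<close>.

  To lower \<open>q\<close> to \<open>r = min q p\<close>, put \<open>d = q - r\<close> and let \<open>t > 0\<close>. By the substitutes property,
  \<open>x i\<close> dominates a Gale demand \<open>z i\<close> at \<open>p\<close>. Raising prices from \<open>p\<close> to \<open>p + t d\<close> does not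
  increase the value of the demand in direction \<open>d\<close>, and neither does lowering them from
  \<open>p + t d\<close> to \<open>r + t d\<close>, which changes only prices of goods outside the support of \<open>d\<close>. So
  total demand at \<open>r + t d\<close> is at most supply in direction \<open>d\<close>, and the dual objective does not
  increase from \<open>q\<close> to \<open>r + t d\<close>; hence these prices also support \<open>y\<close>. Finally \<open>t\<close> tends to \<open>0\<close>.
\<close>

section \<open>The orthant and concave utilities\<close>

lemma orthant_iff: "x \<in> orthant \<longleftrightarrow> (\<forall>j. 0 \<le> x $ j)"
  by (simp add: orthant_def less_eq_vec_def)

lemma zero_in_orthant [simp]: "0 \<in> orthant"
  by (simp add: orthant_iff)

lemma scaleR_in_orthant: "x \<in> orthant \<Longrightarrow> 0 \<le> t \<Longrightarrow> t *\<^sub>R x \<in> orthant"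
  by (simp add: orthant_iff)

lemma convex_orthant: "convex orthant"
  by (auto simp: convex_def orthant_iff)

lemma closed_orthant: "closed (orthant :: (real ^ 'm::finite) set)"
  using closed_eucl_atLeast[of "0 :: real ^ 'm"] by (simp add: orthant_def atLeast_def)

lemma inner_orthant_mono:
  fixes q q' z :: "real ^ 'm::finite"
  assumes "q \<le> q'" "z \<in> orthant"
  shows "q \<bullet> z \<le> q' \<bullet> z"
  using assms by (auto simp: inner_vec_def orthant_iff less_eq_vec_def intro!: sum_mono mult_right_mono)

lemma inner_orthant_mono_right:
  fixes q z z' :: "real ^ 'm::finite"
  assumes "q \<in> orthant" "z \<le> z'"
  shows "q \<bullet> z \<le> q \<bullet> z'"
  using inner_orthant_mono[OF assms(2,1)] by (simp add: inner_commute)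

lemma inner_orthant_nonneg:
  fixes q z :: "real ^ 'm::finite"
  assumes "q \<in> orthant" "z \<in> orthant"
  shows "0 \<le> q \<bullet> z"
  using inner_orthant_mono[of 0 q z] assms by (simp add: orthant_def)

lemma utility_convex_comb:
  assumes "utility_function u" "x \<in> orthant" "z \<in> orthant" "0 \<le> t" "t \<le> 1"
  shows "(1 - t) * u x + t * u z \<le> u ((1 - t) *\<^sub>R x + t *\<^sub>R z)"
  using assms concave_onD[of orthant u t x z] by (auto simp: utility_function_def)

lemma utility_scale:
  assumes "utility_function u" "x \<in> orthant" "0 \<le> t" "t \<le> 1"
  shows "t * u x \<le> u (t *\<^sub>R x)"
  using utility_convex_comb[OF assms(1) zero_in_orthant assms(2-4)] assms(1)
  by (simp add: utility_function_def)

lemma utility_nonneg: "utility_function u \<Longrightarrow> x \<in> orthant \<Longrightarrow> 0 \<le> u x"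
  by (simp add: utility_function_def)

subsection \<open>Gale demand and its supergradient form\<close>

text \<open>Real-valued form of Gale demand. Only bundles of positive utility compete, so the value
  \<open>ln 0 = 0\<close> never enters.\<close>

definition gale_opt ::
  "(real ^ 'm::finite \<Rightarrow> real) \<Rightarrow> real ^ 'm \<Rightarrow> real \<Rightarrow> real ^ 'm \<Rightarrow> bool" where
  "gale_opt u q b y \<longleftrightarrow> y \<in> orthant \<and> 0 < u y \<and>
     (\<forall>z\<in>orthant. 0 < u z \<longrightarrow> b * ln (u z) - q \<bullet> z \<le> b * ln (u y) - q \<bullet> y)"

lemma gale_objective_pos:
  "0 < u y \<Longrightarrow> gale_objective u q b y = ereal (b * ln (u y) - q \<bullet> y)"
  by (simp add: gale_objective_def elog_def)

lemma gale_objective_nonpos: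
  "0 < b \<Longrightarrow> \<not> 0 < u y \<Longrightarrow> gale_objective u q b y = - \<infinity>"
  by (simp add: gale_objective_def elog_def)

text \<open>Some bundle of positive utility has a finite objective, while zero utility gives
  \<open>- \<infinity>\<close>; so a maximizer has positive utility.\<close>

lemma gale_demand_iff:
  fixes u :: "real ^ 'm::finite \<Rightarrow> real"
  assumes u: "utility_function u" and b: "0 < b"
  shows "y \<in> gale_demand u q b \<longleftrightarrow> gale_opt u q b y"
proof
  assume "y \<in> gale_demand u q b"
  then have y: "y \<in> orthant"
    and le: "\<And>z. z \<in> orthant \<Longrightarrow> gale_objective u q b z \<le> gale_objective u q b y"
    by (auto simp: gale_demand_def is_arg_max_def not_less)
  obtain v where v: "v \<in> orthant" "0 < u v"
    using u by (auto simp: utility_function_def)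
  have pos: "0 < u y"
    using le[OF v(1)] gale_objective_pos[of u v q b, OF v(2)] gale_objective_nonpos[of b u y q] b
    by (cases "0 < u y") auto
  have "b * ln (u z) - q \<bullet> z \<le> b * ln (u y) - q \<bullet> y" if "z \<in> orthant" "0 < u z" for z
    using le[OF that(1)] gale_objective_pos[of u z q b, OF that(2)] gale_objective_pos[of u y q b, OF pos]
    by simp
  with y pos show "gale_opt u q b y" by (simp add: gale_opt_def)
next
  assume y: "gale_opt u q b y"
  have "gale_objective u q b z \<le> gale_objective u q b y" if "z \<in> orthant" for z
  proof (cases "0 < u z")
    case True
    with y that show ?thesis
      by (simp add: gale_opt_def gale_objective_pos)
  next
    case False
    with b show ?thesis by (simp add: gale_objective_nonpos)
  qed
  with y show "y \<in> gale_demand u q b"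
    by (auto simp: gale_demand_def is_arg_max_def not_less gale_opt_def)
qed

text \<open>The concluding sum is the one-sided derivative at \<open>t = 0\<close> of the sum in the
  hypothesis. Instead of differentiating, \<open>ln (1 + s) \<ge> s / (1 + s)\<close> bounds the
  difference quotient below by a term with the same limit.\<close>

lemma first_order_ln:
  fixes b c :: "'a \<Rightarrow> real"
  assumes fin: "finite A" and b: "\<And>i. i \<in> A \<Longrightarrow> 0 \<le> b i" and c: "\<And>i. i \<in> A \<Longrightarrow> - 1 \<le> c i"
    and le: "\<And>t. 0 < t \<Longrightarrow> t < 1 \<Longrightarrow> (\<Sum>i\<in>A. b i * ln (1 + t * c i)) \<le> t * K"
  shows "(\<Sum>i\<in>A. b i * c i) \<le> K"
proof -
  have "((\<lambda>t. \<Sum>i\<in>A. b i * (c i / (1 + t * c i))) \<longlongrightarrow> (\<Sum>i\<in>A. b i * (c i / (1 + 0 * c i)))) (at_right 0)"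
    by (intro tendsto_intros) auto
  moreover have "\<forall>\<^sub>F t in at_right 0. (\<Sum>i\<in>A. b i * (c i / (1 + t * c i))) \<le> K"
    unfolding eventually_at_right_field
  proof (intro exI[of _ "1::real"] conjI allI impI)
    fix t :: real assume t: "0 < t" "t < 1"
    have pos: "0 < 1 + t * c i" if "i \<in> A" for i
    proof -
      have "t * (- 1) \<le> t * c i" using t c[OF that] by (intro mult_left_mono) auto
      with t show ?thesis by simp
    qed
    have "t * (c i / (1 + t * c i)) \<le> ln (1 + t * c i)" if "i \<in> A" for i
      using ln_le_minus_one[of "1 / (1 + t * c i)"] pos[OF that]
      by (simp add: ln_div field_simps)
    then have "(\<Sum>i\<in>A. b i * (t * (c i / (1 + t * c i)))) \<le> (\<Sum>i\<in>A. b i * ln (1 + t * c i))"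
      using b by (intro sum_mono mult_left_mono) auto
    also have "\<dots> \<le> t * K" using le t by blast
    also have "(\<Sum>i\<in>A. b i * (t * (c i / (1 + t * c i)))) = t * (\<Sum>i\<in>A. b i * (c i / (1 + t * c i)))"
      by (simp add: sum_distrib_left mult.left_commute)
    finally show "(\<Sum>i\<in>A. b i * (c i / (1 + t * c i))) \<le> K"
      using t by simp
  qed simp
  ultimately show ?thesis
    using tendsto_upperbound[of "\<lambda>t. \<Sum>i\<in>A. b i * (c i / (1 + t * c i))" _ "at_right 0" K] by simp
qed

text \<open>Concavity puts the utility on the segment above the chord, which is
  \<open>u y * (1 + t * (u z / u y - 1))\<close>; the second claim is its logarithm.\<close>

lemma ln_utility_convex_comb:
  assumes u: "utility_function u" and y: "y \<in> orthant" "0 < u y" and z: "z \<in> orthant"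
    and t: "0 < t" "t < 1"
  shows "0 < u ((1 - t) *\<^sub>R y + t *\<^sub>R z)"
    and "ln (u y) + ln (1 + t * (u z / u y - 1)) \<le> ln (u ((1 - t) *\<^sub>R y + t *\<^sub>R z))"
proof -
  have nn: "0 \<le> u z" using u z by (rule utility_nonneg)
  have conc: "(1 - t) * u y + t * u z \<le> u ((1 - t) *\<^sub>R y + t *\<^sub>R z)"
    using utility_convex_comb[OF u y(1) z] t by simp
  have pos: "0 < (1 - t) * u y + t * u z"
    using t y nn by (intro add_pos_nonneg) auto
  with conc show "0 < u ((1 - t) *\<^sub>R y + t *\<^sub>R z)" by linarith
  have eq: "(1 - t) * u y + t * u z = u y * (1 + t * (u z / u y - 1))"
    using y(2) by (simp add: field_simps)
  then have "0 < 1 + t * (u z / u y - 1)"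
    using pos y(2) by (simp add: zero_less_mult_iff)
  then have "ln (u y) + ln (1 + t * (u z / u y - 1)) = ln ((1 - t) * u y + t * u z)"
    using y(2) unfolding eq by (intro ln_mult_pos[symmetric])
  also have "\<dots> \<le> ln (u ((1 - t) *\<^sub>R y + t *\<^sub>R z))"
    using conc pos by simp
  finally show "ln (u y) + ln (1 + t * (u z / u y - 1)) \<le> ln (u ((1 - t) *\<^sub>R y + t *\<^sub>R z))" .
qed

text \<open>Optimality of \<open>y\<close> is tested along the segment to \<open>z\<close>, and the
  one-sided derivative at \<open>y\<close> gives an inequality linear in \<open>u z\<close>. It also
  covers \<open>u z = 0\<close>.\<close>

lemma gale_opt_supergradient:
  assumes u: "utility_function u" and b: "0 < b" and y: "gale_opt u q b y" and z: "z \<in> orthant"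
  shows "u z \<le> u y * (1 + (q \<bullet> z - q \<bullet> y) / b)"
proof -
  have y': "y \<in> orthant" "0 < u y"
    and opt: "\<And>z. z \<in> orthant \<Longrightarrow> 0 < u z \<Longrightarrow> b * ln (u z) - q \<bullet> z \<le> b * ln (u y) - q \<bullet> y"
    using y by (auto simp: gale_opt_def)
  have nn: "0 \<le> u z" using u z by (rule utility_nonneg)
  let ?c = "u z / u y - 1"
  have "(\<Sum>i\<in>{()}. b * ?c) \<le> q \<bullet> z - q \<bullet> y"
  proof (rule first_order_ln)
    fix t :: real assume t: "0 < t" "t < 1"
    let ?w = "(1 - t) *\<^sub>R y + t *\<^sub>R z"
    note w = ln_utility_convex_comb[OF u y' z t]
    have w': "?w \<in> orthant"
      using convex_orthant y'(1) z t by (intro convexD) auto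
    have "b * (ln (u y) + ln (1 + t * ?c)) \<le> b * ln (u ?w)"
      using w(2) b by (intro mult_left_mono) auto
    then show "(\<Sum>i\<in>{()}. b * ln (1 + t * ?c)) \<le> t * (q \<bullet> z - q \<bullet> y)"
      using opt[OF w' w(1)] by (simp add: algebra_simps inner_add_right)
  qed (use b nn y' in auto)
  then show ?thesis
    using b y'(2) by (simp add: field_simps)
qed

text \<open>The converse, from \<open>ln s \<le> s - 1\<close> at
  \<open>s = u z / u y\<close>.\<close>

lemma gale_optI_supergradient:
  assumes b: "0 < b" and y: "y \<in> orthant" "0 < u y"
    and sg: "\<And>z. z \<in> orthant \<Longrightarrow> u z \<le> u y * (1 + (q \<bullet> z - q \<bullet> y) / b)"
  shows "gale_opt u q b y"
  unfolding gale_opt_def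
proof (intro conjI ballI impI)
  fix z assume z: "z \<in> orthant" "0 < u z"
  have "ln (u z) - ln (u y) \<le> u z / u y - 1"
    using ln_le_minus_one[of "u z / u y"] z y by (simp add: ln_div)
  also have "\<dots> \<le> (q \<bullet> z - q \<bullet> y) / b"
    using sg[OF z(1)] y(2) by (simp add: field_simps)
  finally show "b * ln (u z) - q \<bullet> z \<le> b * ln (u y) - q \<bullet> y"
    using b by (simp add: field_simps)
qed (use y in auto)

subsection \<open>The price domain\<close>

lemma pdom_iff:
  fixes u :: "real ^ 'm::finite \<Rightarrow> real"
  shows "q \<in> pdom u \<longleftrightarrow> q \<in> orthant \<and>
    (\<exists>b>0. \<exists>C. \<forall>y\<in>orthant. 0 < u y \<longrightarrow> b * ln (u y) - q \<bullet> y \<le> C)"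
proof -
  have "(SUP y\<in>orthant. gale_objective u q b y) < \<infinity> \<longleftrightarrow>
      (\<exists>C. \<forall>y\<in>orthant. 0 < u y \<longrightarrow> b * ln (u y) - q \<bullet> y \<le> C)" (is "?L < \<infinity> \<longleftrightarrow> ?R")
    if b: "0 < b" for b
  proof
    assume "?L < \<infinity>"
    then obtain C where "?L < ereal C"
      using less_PInf_Ex_of_nat by auto
    then have "gale_objective u q b y \<le> ereal C" if "y \<in> orthant" for y
      using SUP_upper[OF that, of "gale_objective u q b"] by simp
    then have "\<forall>y\<in>orthant. 0 < u y \<longrightarrow> b * ln (u y) - q \<bullet> y \<le> C"
      using gale_objective_pos[of u _ q b] by fastforce
    then show ?R by blast
  next
    assume ?R
    then obtain C where C: "\<forall>y\<in>orthant. 0 < u y \<longrightarrow> b * ln (u y) - q \<bullet> y \<le> C" by blast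
    have "gale_objective u q b y \<le> ereal C" if "y \<in> orthant" for y
      using C that b by (cases "0 < u y") (auto simp: gale_objective_pos gale_objective_nonpos)
    then have "?L \<le> ereal C" by (intro SUP_least) auto
    then show "?L < \<infinity>" by (rule le_less_trans) simp
  qed
  then show ?thesis unfolding pdom_def by auto
qed

lemma pdom_upward:
  assumes "q \<in> pdom u" "q \<le> q'"
  shows "q' \<in> pdom u"
proof -
  obtain b C where b: "b > 0" and C: "\<And>y. y \<in> orthant \<Longrightarrow> 0 < u y \<Longrightarrow> b * ln (u y) - q \<bullet> y \<le> C"
    and q: "q \<in> orthant"
    using assms(1) by (auto simp: pdom_iff)
  have "b * ln (u y) - q' \<bullet> y \<le> C" if "y \<in> orthant" "0 < u y" for y
    using C[OF that] inner_orthant_mono[OF assms(2) that(1)] by linarith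
  moreover have "q' \<in> orthant" using q assms(2) by (auto simp: orthant_def)
  ultimately show ?thesis using b by (auto simp: pdom_iff)
qed

text \<open>Scaling price and budget by the same factor scales the whole objective, and the price
  domain leaves the budget free.\<close>

lemma pdom_scaleR:
  assumes "q \<in> pdom u" "0 < t"
  shows "t *\<^sub>R q \<in> pdom u"
proof -
  obtain b C where b: "b > 0" and C: "\<And>y. y \<in> orthant \<Longrightarrow> 0 < u y \<Longrightarrow> b * ln (u y) - q \<bullet> y \<le> C"
    and q: "q \<in> orthant"
    using assms(1) by (auto simp: pdom_iff)
  have "(t * b) * ln (u y) - (t *\<^sub>R q) \<bullet> y \<le> t * C" if "y \<in> orthant" "0 < u y" for y
    using mult_left_mono[OF C[OF that], of t] assms(2) by (simp add: algebra_simps)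
  moreover have "t *\<^sub>R q \<in> orthant" using q assms(2) by (intro scaleR_in_orthant) auto
  moreover have "0 < t * b" using b assms(2) by simp
  ultimately show ?thesis by (auto simp: pdom_iff)
qed

lemma gale_opt_in_pdom:
  assumes "gale_opt u q b y" "0 < b" "q \<in> orthant"
  shows "q \<in> pdom u"
  using assms by (auto simp: pdom_iff gale_opt_def)

section \<open>Existence of Gale demands\<close>

lemma compact_budget_set:
  fixes q :: "real ^ 'm::finite"
  assumes q: "\<And>j. 0 < q $ j"
  shows "compact {y \<in> orthant. q \<bullet> y \<le> R}"
proof -
  have "closed (orthant \<inter> {y. q \<bullet> y \<le> R})"
    by (intro closed_Int closed_orthant closed_Collect_le continuous_intros)
  moreover have "{y \<in> orthant. q \<bullet> y \<le> R} \<subseteq> cbox 0 (\<chi> j. R / q $ j)"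
  proof
    fix y assume y: "y \<in> {y \<in> orthant. q \<bullet> y \<le> R}"
    have "y $ j \<le> R / q $ j" for j
    proof -
      have "q $ j * y $ j \<le> (\<Sum>k\<in>UNIV. q $ k * y $ k)"
        using y q by (intro member_le_sum) (auto simp: orthant_iff less_imp_le)
      also have "\<dots> = q \<bullet> y" by (simp add: inner_vec_def)
      also have "\<dots> \<le> R" using y by simp
      finally show ?thesis using q[of j] by (simp add: field_simps)
    qed
    then show "y \<in> cbox 0 (\<chi> j. R / q $ j)"
      using y by (auto simp: mem_box_cart orthant_iff)
  qed
  ultimately show ?thesis
    using bounded_subset[OF bounded_cbox] by (simp add: compact_eq_bounded_closed Int_def)
qed

text \<open>At strictly positive prices the objective is coercive: concave utility grows at most
  linearly in the cost, so its logarithm loses against the cost, and a maximum over a large compact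
  budget set is global.\<close>

lemma gale_opt_exists_pos:
  fixes u :: "real ^ 'm::finite \<Rightarrow> real"
  assumes u: "utility_function u" and b: "0 < b" and q: "\<And>j. 0 < q $ j"
  shows "\<exists>y. gale_opt u q b y"
proof -
  have cont: "continuous_on orthant u" using u by (simp add: utility_function_def)
  have qo: "q \<in> orthant" using q by (simp add: orthant_iff less_imp_le)
  obtain v where v: "v \<in> orthant" "0 < u v"
    using u by (auto simp: utility_function_def)
  let ?S = "\<lambda>R. {y \<in> orthant. q \<bullet> y \<le> R}"
  let ?g = "\<lambda>y. b * ln (u y) - q \<bullet> y"
  have "compact (u ` ?S 1)"
    by (intro compact_continuous_image compact_budget_set q continuous_on_subset[OF cont]) auto
  then have "bdd_above (u ` ?S 1)"
    by (intro bounded_imp_bdd_above compact_imp_bounded)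
  then obtain K0 where K0: "\<And>y. y \<in> ?S 1 \<Longrightarrow> u y \<le> K0"
    unfolding bdd_above_def by blast
  define K where "K = max 1 K0"
  have K: "0 < K" "\<And>y. y \<in> ?S 1 \<Longrightarrow> u y \<le> K"
    using K0 by (auto simp: K_def le_max_iff_disj)
  have growth: "u y \<le> K * (1 + q \<bullet> y)" if y: "y \<in> orthant" for y
  proof -
    define s where "s = 1 + q \<bullet> y"
    have s: "1 \<le> s" using inner_orthant_nonneg[OF qo y] by (simp add: s_def)
    \<comment> \<open>Dividing by \<open>1 + q \<bullet> y\<close> brings the cost below
      \<open>1\<close>; concavity with \<open>u 0 = 0\<close> carries the bound on
      \<open>?S 1\<close> back to \<open>y\<close>.\<close>
    have "(1 / s) *\<^sub>R y \<in> ?S 1"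
      using s y by (auto intro!: scaleR_in_orthant simp: s_def field_simps)
    then have "u ((1 / s) *\<^sub>R y) \<le> K" by (rule K(2))
    moreover have "(1 / s) * u y \<le> u ((1 / s) *\<^sub>R y)"
      using s by (intro utility_scale[OF u y]) auto
    ultimately have "(1 / s) * u y \<le> K" by linarith
    then show ?thesis using s by (simp add: s_def[symmetric] field_simps)
  qed
  have coercive: "?g y \<le> b * ln (2 * b * K) + 1 / 2 - (q \<bullet> y) / 2" if y: "y \<in> orthant" "0 < u y" for y
  proof -
    define s where "s = 1 + q \<bullet> y"
    have s: "1 \<le> s" using inner_orthant_nonneg[OF qo y(1)] by (simp add: s_def)
    \<comment> \<open>The factor \<open>2 * b\<close> is split off so that the linear bound on the
      logarithm, multiplied by \<open>b\<close>, uses up only half of the cost.\<close>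
    have "ln (u y) \<le> ln ((2 * b * K) * (s / (2 * b)))"
      using growth[OF y(1)] y(2) b by (simp add: s_def)
    also have "\<dots> = ln (2 * b * K) + ln (s / (2 * b))"
      using b K s by (intro ln_mult_pos) auto
    also have "ln (s / (2 * b)) \<le> s / (2 * b)"
      using ln_le_minus_one[of "s / (2 * b)"] b s by simp
    finally have "b * ln (u y) \<le> b * (ln (2 * b * K) + s / (2 * b))"
      using b by (intro mult_left_mono) auto
    also have "\<dots> = b * ln (2 * b * K) + s / 2" using b by (simp add: field_simps)
    finally show ?thesis by (simp add: s_def field_simps)
  qed
  \<comment> \<open>\<open>R\<close> puts \<open>v\<close> inside the budget set and makes the
    coercive bound outside it at most the objective at \<open>v\<close>.\<close>
  define R where "R = max (q \<bullet> v) (2 * (b * ln (2 * b * K) + 1 / 2 - ?g v))"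
  \<comment> \<open>The exponential of the objective, extended continuously by \<open>0\<close> to
    bundles of zero utility.\<close>
  let ?h = "\<lambda>y. u y powr b * exp (- (q \<bullet> y))"
  have "continuous_on (?S R) ?h"
    using b u by (intro continuous_intros continuous_on_powr' continuous_on_subset[OF cont])
      (auto simp: utility_function_def)
  moreover have vS: "v \<in> ?S R" using v by (simp add: R_def)
  ultimately obtain y where y: "y \<in> ?S R" and max: "\<And>z. z \<in> ?S R \<Longrightarrow> ?h z \<le> ?h y"
    using continuous_attains_sup[OF compact_budget_set[OF q], of R ?h] by blast
  have "0 < ?h v" using v by simp
  then have "0 < ?h y" using max[OF vS] by linarith
  then have ypos: "0 < u y"
    using y u utility_nonneg[OF u, of y] by (cases "u y = 0") auto
  have lnh: "ln (?h z) = ?g z" if "0 < u z" for z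
    using that by (simp add: ln_mult ln_powr)
  have inside: "?g z \<le> ?g y" if "z \<in> ?S R" "0 < u z" for z
  proof -
    have "ln (?h z) \<le> ln (?h y)"
      using max[OF that(1)] that(2) ypos by simp
    then show ?thesis using lnh that(2) ypos by simp
  qed
  have "?g z \<le> ?g y" if z: "z \<in> orthant" "0 < u z" for z
  proof (cases "q \<bullet> z \<le> R")
    case True
    with z show ?thesis by (intro inside) auto
  next
    case False
    then have "?g z \<le> ?g v" using coercive[OF z] by (simp add: R_def)
    also have "\<dots> \<le> ?g y" using inside[OF vS v(2)] .
    finally show ?thesis .
  qed
  with y ypos show ?thesis by (auto simp: gale_opt_def)
qed

section \<open>The substitutes property for \<open>gale_opt\<close>\<close>

lemma gale_substitutes_price:
  fixes u :: "real ^ 'm::finite \<Rightarrow> real"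
  assumes "utility_function u" "gale_substitutes u" "0 < b" "q \<in> pdom u" "q' \<in> pdom u" "q' \<le> q"
    "gale_opt u q b y"
  obtains y' where "gale_opt u q' b y'" "\<And>j. q' $ j = q $ j \<Longrightarrow> y' $ j \<le> y $ j"
proof -
  have "y \<in> gale_demand u q b" using assms by (simp add: gale_demand_iff)
  then obtain y' where "y' \<in> gale_demand u q' b" "\<forall>j. q' $ j = q $ j \<longrightarrow> y' $ j \<le> y $ j"
    using assms(2-6) unfolding gale_substitutes_def by blast
  with assms(1,3) that show thesis by (auto simp: gale_demand_iff)
qed

lemma gale_substitutes_budget:
  fixes u :: "real ^ 'm::finite \<Rightarrow> real"
  assumes "utility_function u" "gale_substitutes u" "0 < b'" "b' \<le> b" "q \<in> pdom u"
    "gale_opt u q b y"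
  obtains y' where "gale_opt u q b' y'" "y' \<le> y"
proof -
  have b: "0 < b" using assms by linarith
  then have "y \<in> gale_demand u q b" using assms by (simp add: gale_demand_iff)
  then obtain y' where "y' \<in> gale_demand u q b'" "y' \<le> y"
    using assms(2-5) unfolding gale_substitutes_def by blast
  with assms(1,3) that show thesis by (auto simp: gale_demand_iff)
qed

text \<open>
  For a utility such as \<open>y / (1 + y)\<close> the supremum at price \<open>0\<close> is finite but not attained. The
  substitutes property rules this out by transporting an optimal bundle down from positive prices.
\<close>

lemma gale_opt_exists:
  fixes u :: "real ^ 'm::finite \<Rightarrow> real"
  assumes u: "utility_function u" and gs: "gale_substitutes u" and b: "0 < b" and q: "q \<in> pdom u"
  shows "\<exists>y. gale_opt u q b y"
proof -
  have q1: "0 < (q + 1) $ j" for j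
    using q by (auto simp: pdom_def orthant_iff add_nonneg_pos)
  have le: "q \<le> q + 1" by (simp add: less_eq_vec_def)
  obtain y where "gale_opt u (q + 1) b y"
    using gale_opt_exists_pos[OF u b q1] by blast
  then show ?thesis
    using gale_substitutes_price[OF u gs b pdom_upward[OF q le] q le] by metis
qed

subsection \<open>Lagrange multipliers\<close>

text \<open>Pairs are (value, resources). A hyperplane separates \<open>(B, c)\<close> from
  \<open>C\<close>; monotonicity of \<open>C\<close> fixes the signs of its normal, the Slater point
  keeps it from being vertical, and normalizing the value coefficient yields
  \<open>q\<close>.\<close>

lemma lagrange_multiplier:
  fixes C :: "(real \<times> 'e::ordered_euclidean_space) set"
  assumes conv: "convex C" and notin: "(B, c) \<notin> C"
    and down: "\<And>a s a' s'. (a, s) \<in> C \<Longrightarrow> a' \<le> a \<Longrightarrow> s \<le> s' \<Longrightarrow> (a', s') \<in> C"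
    and slater: "(a0, s0) \<in> C" "\<And>i. i \<in> Basis \<Longrightarrow> s0 \<bullet> i < c \<bullet> i"
  obtains q where "0 \<le> q" "\<And>a s. (a, s) \<in> C \<Longrightarrow> a - q \<bullet> s \<le> B - q \<bullet> c"
proof -
  have "convex ((\<lambda>w. w - (B, c)) ` C)"
    using conv by (rule convex_translation_subtract)
  moreover have "0 \<notin> (\<lambda>w. w - (B, c)) ` C"
    using notin by (metis (no_types, lifting) eq_iff_diff_eq_0 imageE)
  ultimately obtain n where n: "n \<noteq> 0" "\<forall>w\<in>(\<lambda>w. w - (B, c)) ` C. 0 \<le> n \<bullet> w"
    using separating_hyperplane_set_0 by blast
  obtain \<alpha> k where nk: "n = (\<alpha>, k)" by (cases n)
  have sep: "\<alpha> * B + k \<bullet> c \<le> \<alpha> * a + k \<bullet> s" if "(a, s) \<in> C" for a s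
    using n(2) that nk by (force simp: inner_diff_right algebra_simps)
  have nonneg: "0 \<le> m"
    if "\<And>r. 0 \<le> r \<Longrightarrow> e \<le> f + r * m" for e f m :: real
  proof (rule ccontr)
    assume "\<not> 0 \<le> m"
    then have m: "m < 0" by simp
    \<comment> \<open>This \<open>r\<close> gives \<open>f + r * m \<le> e - 1\<close>, against the
      assumed bound.\<close>
    define r where "r = max 0 ((f - e + 1) / (- m))"
    have "(f - e + 1) / (- m) * (- m) \<le> r * (- m)"
      using m by (intro mult_right_mono) (auto simp: r_def)
    then have "f - e + 1 \<le> - (r * m)" using m by simp
    then show False using that[of r] by (simp add: r_def)
  qed
  have k: "0 \<le> k \<bullet> i" if i: "i \<in> Basis" for i
  proof (rule nonneg)
    fix r :: real assume r: "0 \<le> r"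
    have "s0 \<le> s0 + r *\<^sub>R i"
      using r i by (auto simp: eucl_le[where 'a = 'e] inner_add_left inner_Basis)
    then have "(a0, s0 + r *\<^sub>R i) \<in> C" using down[OF slater(1)] by simp
    from sep[OF this] show "\<alpha> * B + k \<bullet> c \<le> (\<alpha> * a0 + k \<bullet> s0) + r * (k \<bullet> i)"
      by (simp add: inner_add_right)
  qed
  have "0 \<le> - \<alpha>"
  proof (rule nonneg)
    fix r :: real assume r: "0 \<le> r"
    then have "(a0 - r, s0) \<in> C" using down[OF slater(1)] by simp
    from sep[OF this] show "\<alpha> * B + k \<bullet> c \<le> (\<alpha> * a0 + k \<bullet> s0) + r * (- \<alpha>)"
      by (simp add: algebra_simps)
  qed
  \<comment> \<open>If \<open>\<alpha> = 0\<close>, then \<open>k \<ge> 0\<close> and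
    \<open>k \<bullet> (c - s0) \<le> 0\<close>, where all components of \<open>c - s0\<close> are
    positive; this forces \<open>k = 0\<close>.\<close>
  moreover have "\<alpha> \<noteq> 0"
  proof
    assume \<alpha>: "\<alpha> = 0"
    then have "k \<bullet> c \<le> k \<bullet> s0" using sep[OF slater(1)] by simp
    then have "(\<Sum>i\<in>Basis. (k \<bullet> i) * ((c - s0) \<bullet> i)) \<le> 0"
      using euclidean_inner[of k "c - s0"] by (simp add: inner_diff_right)
    moreover have "0 \<le> (k \<bullet> i) * ((c - s0) \<bullet> i)" if "i \<in> Basis" for i
      using k[OF that] slater(2)[OF that] by (simp add: inner_diff_left)
    ultimately have "\<forall>i\<in>Basis. (k \<bullet> i) * ((c - s0) \<bullet> i) = 0"
      by (metis (no_types, lifting) finite_Basis order_antisym sum_nonneg sum_nonneg_eq_0_iff)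
    then have "\<forall>i\<in>Basis. k \<bullet> i = 0"
      using slater(2) by (force simp: inner_diff_left)
    then have "k = 0" by (simp add: euclidean_all_zero_iff)
    with \<alpha> n(1) nk show False by (simp add: zero_prod_def)
  qed
  ultimately have \<alpha>: "\<alpha> < 0" by simp
  show thesis
  proof (rule that[of "(1 / (- \<alpha>)) *\<^sub>R k"])
    show "0 \<le> (1 / (- \<alpha>)) *\<^sub>R k"
      using k \<alpha> by (simp add: eucl_le[where 'a = 'e] divide_nonneg_neg divide_nonpos_neg)
    fix a s assume "(a, s) \<in> C"
    from mult_left_mono[OF sep[OF this], of "1 / (- \<alpha>)"]
    show "a - ((1 / (- \<alpha>)) *\<^sub>R k) \<bullet> s \<le> B - ((1 / (- \<alpha>)) *\<^sub>R k) \<bullet> c"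
      using \<alpha> by (simp add: distrib_left add_divide_distrib)
  qed
qed

subsection \<open>Supporting prices\<close>

text \<open>Bundles of positive utility can be scaled down to a feasible allocation of positive
  welfare, so no factor of the maximal product vanishes and logarithms apply.\<close>

lemma nash_welfare_positive_optimum:
  fixes u :: "'a \<Rightarrow> real ^ 'm::finite \<Rightarrow> real"
  assumes fm: "fisher_market A b u" and A: "A \<noteq> {}" and nw: "nash_welfare_maximizing A b u y"
  shows "\<And>i. i \<in> A \<Longrightarrow> 0 < u i (y i)"
    and "\<And>z. feasible_allocation A z \<Longrightarrow> (\<And>i. i \<in> A \<Longrightarrow> 0 < u i (z i)) \<Longrightarrow>
           (\<Sum>i\<in>A. b i * ln (u i (z i))) \<le> (\<Sum>i\<in>A. b i * ln (u i (y i)))"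
proof -
  have fin: "finite A" and b: "\<And>i. i \<in> A \<Longrightarrow> 0 < b i"
    and ut: "\<And>i. i \<in> A \<Longrightarrow> utility_function (u i)"
    using fm by (auto simp: fisher_market_def)
  have yf: "feasible_allocation A y"
    and le: "\<And>z. feasible_allocation A z \<Longrightarrow> nash_welfare A b u z \<le> nash_welfare A b u y"
    using nw by (auto simp: nash_welfare_maximizing_def is_arg_max_def not_less)
  have B: "0 < (\<Sum>i\<in>A. b i)" using fin A b by (intro sum_pos) auto
  have "\<forall>i\<in>A. \<exists>v. v \<in> orthant \<and> 0 < u i v"
    using ut by (auto simp: utility_function_def)
  then obtain v where v: "\<And>i. i \<in> A \<Longrightarrow> v i \<in> orthant" "\<And>i. i \<in> A \<Longrightarrow> 0 < u i (v i)"
    by metis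
  \<comment> \<open>\<open>M\<close> is at least \<open>1\<close>, as \<open>utility_scale\<close>
    needs for the factor \<open>1 / M\<close>, and at least the total use of each good.\<close>
  define M where "M = 1 + (\<Sum>i\<in>A. \<Sum>j\<in>UNIV. v i $ j)"
  have M: "1 \<le> M"
    using v(1) by (auto simp: M_def orthant_iff intro!: sum_nonneg)
  define w where "w i = (1 / M) *\<^sub>R v i" for i
  have w: "w i \<in> orthant" "0 < u i (w i)" if i: "i \<in> A" for i
  proof -
    show "w i \<in> orthant" using v(1)[OF i] M by (simp add: w_def scaleR_in_orthant)
    have "0 < (1 / M) * u i (v i)" using v(2)[OF i] M by simp
    also have "\<dots> \<le> u i (w i)"
      unfolding w_def using M by (intro utility_scale ut v(1) i) auto
    finally show "0 < u i (w i)" .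
  qed
  have "(\<Sum>i\<in>A. w i $ j) \<le> 1" for j
  proof -
    have "(\<Sum>i\<in>A. v i $ j) \<le> (\<Sum>i\<in>A. \<Sum>j\<in>UNIV. v i $ j)"
      using v(1) by (intro sum_mono member_le_sum) (auto simp: orthant_iff)
    then have "(\<Sum>i\<in>A. v i $ j) \<le> M" by (simp add: M_def)
    moreover have "(\<Sum>i\<in>A. w i $ j) = (\<Sum>i\<in>A. v i $ j) / M"
      by (simp add: w_def sum_divide_distrib)
    ultimately show ?thesis using M by simp
  qed
  with w(1) have wf: "feasible_allocation A w" by (simp add: feasible_allocation_def)
  have prod_pos: "0 < (\<Prod>i\<in>A. u i (z i) powr b i)" if "\<And>i. i \<in> A \<Longrightarrow> 0 < u i (z i)" for z
    using that by (intro prod_pos) (metis less_irrefl powr_gt_zero)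
  have "0 < nash_welfare A b u w"
    using prod_pos[OF w(2)] by (simp add: nash_welfare_def)
  then have "0 < nash_welfare A b u y" using le[OF wf] by linarith
  then have "(\<Prod>i\<in>A. u i (y i) powr b i) \<noteq> 0"
    by (auto simp: nash_welfare_def)
  then have "u i (y i) \<noteq> 0" if "i \<in> A" for i
    using that fin by (metis powr_0 prod_zero)
  then show ypos: "0 < u i (y i)" if "i \<in> A" for i
    using that utility_nonneg[OF ut[OF that], of "y i"] yf
    by (fastforce simp: feasible_allocation_def)
  fix z assume zf: "feasible_allocation A z" and zpos: "\<And>i. i \<in> A \<Longrightarrow> 0 < u i (z i)"
  have ln_nw: "ln (\<Prod>i\<in>A. u i (z i) powr b i) = (\<Sum>i\<in>A. b i * ln (u i (z i)))"
    if "\<And>i. i \<in> A \<Longrightarrow> 0 < u i (z i)" for z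
  proof -
    have "ln (\<Prod>i\<in>A. u i (z i) powr b i) = (\<Sum>i\<in>A. ln (u i (z i) powr b i))"
      using that by (intro ln_prod fin) (metis less_irrefl powr_eq_0_iff)
    also have "\<dots> = (\<Sum>i\<in>A. b i * ln (u i (z i)))"
      using that by (intro sum.cong) (auto simp: ln_powr)
    finally show ?thesis .
  qed
  have "(\<Prod>i\<in>A. u i (z i) powr b i) \<le> (\<Prod>i\<in>A. u i (y i) powr b i)"
  proof (rule ccontr)
    assume "\<not> ?thesis"
    then have "nash_welfare A b u y < nash_welfare A b u z"
      unfolding nash_welfare_def using prod_pos[OF ypos] B
      by (intro powr_less_mono2) auto
    with le[OF zf] show False by simp
  qed
  then have "ln (\<Prod>i\<in>A. u i (z i) powr b i) \<le> ln (\<Prod>i\<in>A. u i (y i) powr b i)"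
    using prod_pos[OF zpos] by simp
  then show "(\<Sum>i\<in>A. b i * ln (u i (z i))) \<le> (\<Sum>i\<in>A. b i * ln (u i (y i)))"
    using ln_nw[OF zpos] ln_nw[OF ypos] by simp
qed

text \<open>Moving from \<open>y\<close> towards \<open>z\<close> stays feasible, so log welfare has
  nonpositive derivative in that direction. Hence \<open>y\<close> also maximizes the welfare
  linearized in the utilities.\<close>

lemma nash_first_order:
  fixes u :: "'a \<Rightarrow> real ^ 'm::finite \<Rightarrow> real"
  assumes fm: "fisher_market A b u" and A: "A \<noteq> {}" and nw: "nash_welfare_maximizing A b u y"
    and zf: "feasible_allocation A z"
  shows "(\<Sum>i\<in>A. b i * (u i (z i) / u i (y i))) \<le> (\<Sum>i\<in>A. b i)"
proof -
  have fin: "finite A" and b: "\<And>i. i \<in> A \<Longrightarrow> 0 < b i"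
    and ut: "\<And>i. i \<in> A \<Longrightarrow> utility_function (u i)"
    using fm by (auto simp: fisher_market_def)
  note ypos = nash_welfare_positive_optimum(1)[OF fm A nw]
  note opt = nash_welfare_positive_optimum(2)[OF fm A nw]
  have yf: "feasible_allocation A y"
    using nw by (simp add: nash_welfare_maximizing_def is_arg_max_def)
  have yo: "\<And>i. i \<in> A \<Longrightarrow> y i \<in> orthant" and zo: "\<And>i. i \<in> A \<Longrightarrow> z i \<in> orthant"
    using yf zf by (auto simp: feasible_allocation_def)
  have "(\<Sum>i\<in>A. b i * (u i (z i) / u i (y i) - 1)) \<le> 0"
  proof (rule first_order_ln)
    fix t :: real assume t: "0 < t" "t < 1"
    define w where "w i = (1 - t) *\<^sub>R y i + t *\<^sub>R z i" for i
    have w: "0 < u i (w i)"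
      "ln (u i (y i)) + ln (1 + t * (u i (z i) / u i (y i) - 1)) \<le> ln (u i (w i))"
      if "i \<in> A" for i
      using ln_utility_convex_comb[OF ut yo ypos zo t] that by (auto simp: w_def)
    have "(\<Sum>i\<in>A. w i $ j) \<le> 1" for j
    proof -
      have "(\<Sum>i\<in>A. w i $ j) = (1 - t) * (\<Sum>i\<in>A. y i $ j) + t * (\<Sum>i\<in>A. z i $ j)"
        by (simp add: w_def sum.distrib sum_distrib_left)
      also have "\<dots> \<le> (1 - t) * 1 + t * 1"
        using yf zf t by (intro add_mono mult_left_mono) (auto simp: feasible_allocation_def)
      finally show ?thesis by simp
    qed
    moreover have "w i \<in> orthant" if "i \<in> A" for i
      unfolding w_def using yo[OF that] zo[OF that] t by (intro convexD convex_orthant) auto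
    ultimately have "feasible_allocation A w" by (simp add: feasible_allocation_def)
    then have "(\<Sum>i\<in>A. b i * ln (u i (w i))) \<le> (\<Sum>i\<in>A. b i * ln (u i (y i)))"
      using w(1) by (rule opt)
    moreover have "(\<Sum>i\<in>A. b i * (ln (u i (y i)) + ln (1 + t * (u i (z i) / u i (y i) - 1))))
        \<le> (\<Sum>i\<in>A. b i * ln (u i (w i)))"
      using w(2) b by (intro sum_mono mult_left_mono) (auto intro: less_imp_le)
    ultimately show "(\<Sum>i\<in>A. b i * ln (1 + t * (u i (z i) / u i (y i) - 1))) \<le> t * 0"
      by (simp add: distrib_left sum.distrib)
  next
    show "- 1 \<le> u i (z i) / u i (y i) - 1" if "i \<in> A" for i
      using utility_nonneg[OF ut zo] ypos that by (simp add: less_imp_le)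
  qed (use fin b in \<open>auto intro: less_imp_le\<close>)
  then show ?thesis by (simp add: right_diff_distrib sum_subtractf)
qed

text \<open>The linearized welfare \<open>F\<close> is concave and maximal at \<open>y\<close>;
  \<open>q\<close> is the multiplier of the supply constraint. The Lagrangian splits over agents
  into supergradient inequalities.\<close>

lemma nash_supporting_prices:
  fixes u :: "'a \<Rightarrow> real ^ 'm::finite \<Rightarrow> real"
  assumes fm: "fisher_market A b u" and A: "A \<noteq> {}" and nw: "nash_welfare_maximizing A b u y"
  obtains q where "q \<in> orthant" "\<And>i. i \<in> A \<Longrightarrow> gale_opt (u i) q (b i) (y i)"
    "q \<bullet> (\<Sum>i\<in>A. y i) = q \<bullet> 1"
proof -
  have fin: "finite A" and b: "\<And>i. i \<in> A \<Longrightarrow> 0 < b i"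
    and ut: "\<And>i. i \<in> A \<Longrightarrow> utility_function (u i)"
    using fm by (auto simp: fisher_market_def)
  note ypos = nash_welfare_positive_optimum(1)[OF fm A nw]
  have yf: "feasible_allocation A y"
    using nw by (simp add: nash_welfare_maximizing_def is_arg_max_def)
  have yo: "\<And>i. i \<in> A \<Longrightarrow> y i \<in> orthant"
    using yf by (auto simp: feasible_allocation_def)
  define F where "F z = (\<Sum>i\<in>A. b i * (u i (z i) / u i (y i)))" for z
  \<comment> \<open>The strict \<open>a < F z\<close> keeps the optimal value paired with the full
    supply outside \<open>C\<close>.\<close>
  define C where "C = {(a, s). \<exists>z. (\<forall>i\<in>A. z i \<in> orthant) \<and> a < F z \<and> (\<Sum>i\<in>A. z i) \<le> s}"
  have CI: "(a, s) \<in> C" if "\<And>i. i \<in> A \<Longrightarrow> z i \<in> orthant" "a < F z" "(\<Sum>i\<in>A. z i) \<le> s" for a s z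
    using that unfolding C_def by blast
  have conv: "convex C"
  proof (rule convexI)
    fix w w' :: "real \<times> (real ^ 'm)" and \<theta> \<tau> :: real
    assume w: "w \<in> C" "w' \<in> C" and \<theta>: "0 \<le> \<theta>" "0 \<le> \<tau>" "\<theta> + \<tau> = 1"
    obtain a s z where as: "w = (a, s)" "\<forall>i\<in>A. z i \<in> orthant" "a < F z" "(\<Sum>i\<in>A. z i) \<le> s"
      using w(1) by (auto simp: C_def)
    obtain a' s' z' where as': "w' = (a', s')" "\<forall>i\<in>A. z' i \<in> orthant" "a' < F z'" "(\<Sum>i\<in>A. z' i) \<le> s'"
      using w(2) by (auto simp: C_def)
    define v where "v i = \<theta> *\<^sub>R z i + \<tau> *\<^sub>R z' i" for i
    have "\<theta> * a + \<tau> * a' < F v"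
    proof -
      have "\<theta> * a + \<tau> * a' < \<theta> * F z + \<tau> * F z'"
      proof (cases "\<theta> = 0")
        case True
        with \<theta> as' show ?thesis by simp
      next
        case False
        with \<theta> as(3) as'(3) show ?thesis
          by (intro add_less_le_mono mult_strict_left_mono mult_left_mono) auto
      qed
      also have "\<dots> = (\<Sum>i\<in>A. b i * ((\<theta> * u i (z i) + \<tau> * u i (z' i)) / u i (y i)))"
        by (simp add: F_def sum_distrib_left sum.distrib[symmetric] field_simps add_divide_distrib)
      also have "\<dots> \<le> F v"
        unfolding F_def
      proof (intro sum_mono mult_left_mono divide_right_mono)
        fix i assume i: "i \<in> A"
        have "\<theta> = 1 - \<tau>" "\<tau> \<le> 1" using \<theta> by auto
        then show "\<theta> * u i (z i) + \<tau> * u i (z' i) \<le> u i (v i)"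
          using utility_convex_comb[OF ut[OF i], of "z i" "z' i" \<tau>] i as(2) as'(2) \<theta>
          unfolding v_def by metis
      qed (use b ypos in \<open>auto intro: less_imp_le\<close>)
      finally show ?thesis .
    qed
    moreover have "(\<Sum>i\<in>A. v i) \<le> \<theta> *\<^sub>R s + \<tau> *\<^sub>R s'"
    proof -
      have "(\<Sum>i\<in>A. v i) = \<theta> *\<^sub>R (\<Sum>i\<in>A. z i) + \<tau> *\<^sub>R (\<Sum>i\<in>A. z' i)"
        by (simp add: v_def sum.distrib scaleR_right.sum)
      then show ?thesis
        using as(4) as'(4) \<theta> by (auto intro!: add_mono scaleR_left_mono)
    qed
    moreover have "v i \<in> orthant" if "i \<in> A" for i
      unfolding v_def using as(2) as'(2) that \<theta> by (intro convexD convex_orthant) auto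
    ultimately show "\<theta> *\<^sub>R w + \<tau> *\<^sub>R w' \<in> C"
      using CI[of v] as(1) as'(1) by simp
  qed
  have notin: "((\<Sum>i\<in>A. b i), 1) \<notin> C"
  proof
    assume "((\<Sum>i\<in>A. b i), 1) \<in> C"
    then obtain z where z: "\<forall>i\<in>A. z i \<in> orthant" "(\<Sum>i\<in>A. b i) < F z" "(\<Sum>i\<in>A. z i) \<le> 1"
      by (auto simp: C_def)
    then have "feasible_allocation A z"
      by (simp add: feasible_allocation_def less_eq_vec_def)
    from nash_first_order[OF fm A nw this] z(2) show False by (simp add: F_def)
  qed
  have down: "(a', s') \<in> C" if "(a, s) \<in> C" "a' \<le> a" "s \<le> s'" for a s a' s'
    using that unfolding C_def by (blast intro: le_less_trans order_trans)
  have "F (\<lambda>_. 0) = 0" using ut by (simp add: F_def utility_function_def)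
  \<comment> \<open>The zero allocation uses no supply and its value exceeds
    \<open>-1\<close>.\<close>
  then have slater: "(-1, 0) \<in> C" by (intro CI[of "\<lambda>_. 0"]) auto
  have slater': "0 \<bullet> i < (1 :: real ^ 'm) \<bullet> i" if "i \<in> Basis" for i
    using that by (auto simp: Basis_vec_def inner_axis)
  obtain q where q: "0 \<le> q" and sep: "\<And>a s. (a, s) \<in> C \<Longrightarrow> a - q \<bullet> s \<le> (\<Sum>i\<in>A. b i) - q \<bullet> 1"
    by (rule lagrange_multiplier[OF conv notin _ slater]) (use down slater' in blast)+
  have le: "F z - q \<bullet> (\<Sum>i\<in>A. z i) \<le> (\<Sum>i\<in>A. b i) - q \<bullet> 1" if z: "\<And>i. i \<in> A \<Longrightarrow> z i \<in> orthant" for z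
  proof (rule field_le_epsilon)
    fix e :: real assume "0 < e"
    then have "(F z - e, \<Sum>i\<in>A. z i) \<in> C" using z by (intro CI[of z]) auto
    from sep[OF this] show "F z - q \<bullet> (\<Sum>i\<in>A. z i) \<le> (\<Sum>i\<in>A. b i) - q \<bullet> 1 + e" by simp
  qed
  have qo: "q \<in> orthant" using q by (simp add: orthant_def)
  have Fy: "F y = (\<Sum>i\<in>A. b i)"
    unfolding F_def using ypos by (intro sum.cong) (auto simp: less_imp_neq[symmetric])
  have "(\<Sum>i\<in>A. y i) \<le> 1" using yf by (simp add: feasible_allocation_def less_eq_vec_def)
  then have "q \<bullet> (\<Sum>i\<in>A. y i) \<le> q \<bullet> 1" using qo by (rule inner_orthant_mono_right[rotated])
  \<comment> \<open>Complementary slackness: the Lagrangian bound at \<open>y\<close> gives the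
    reverse inequality.\<close>
  with le[of y] yo Fy have slack: "q \<bullet> (\<Sum>i\<in>A. y i) = q \<bullet> 1" by simp
  have "gale_opt (u i) q (b i) (y i)" if i: "i \<in> A" for i
  proof (intro gale_optI_supergradient b yo ypos i)
    fix z :: "real ^ 'm" assume z: "z \<in> orthant"
    \<comment> \<open>By slackness \<open>y\<close> maximizes the Lagrangian over all orthant
      allocations, feasible or not; so one bundle may be replaced by any \<open>z\<close>, and the
      terms of the other agents cancel.\<close>
    have "F (y(i := z)) - q \<bullet> (\<Sum>k\<in>A. (y(i := z)) k) \<le> F y - q \<bullet> (\<Sum>k\<in>A. y k)"
      using le[of "y(i := z)"] yo z slack Fy by auto
    then have "b i * (u i z / u i (y i)) - q \<bullet> z \<le> b i * (u i (y i) / u i (y i)) - q \<bullet> y i"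
      unfolding F_def using sum.remove[OF fin i, of "\<lambda>k. b k * (u k ((y(i := z)) k) / u k (y k))"]
        sum.remove[OF fin i, of "\<lambda>k. b k * (u k (y k) / u k (y k))"]
        sum.remove[OF fin i, of "y(i := z)"] sum.remove[OF fin i, of y]
      by (simp add: inner_add_right)
    then show "u i z \<le> u i (y i) * (1 + (q \<bullet> z - q \<bullet> y i) / b i)"
      using ypos[OF i] b[OF i] by (simp add: field_simps)
  qed
  with qo slack that show thesis by blast
qed

section \<open>Equilibrium bundles and Gale demand\<close>

text \<open>\<open>l\<close> is the multiplier of the budget constraint, the marginal utility of
  money; the zero bundle costs less than \<open>b\<close> and supplies the Slater point.\<close>

lemma equilibrium_multiplier:
  fixes u :: "real ^ 'm::finite \<Rightarrow> real"
  assumes u: "utility_function u" and b: "0 < b"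
    and max: "is_arg_max u (\<lambda>z. z \<in> orthant \<and> p \<bullet> z \<le> b) x"
  obtains l where "0 \<le> l" "\<And>z. z \<in> orthant \<Longrightarrow> u z \<le> u x + l * (p \<bullet> z - b)"
proof -
  have opt: "\<And>z. z \<in> orthant \<Longrightarrow> p \<bullet> z \<le> b \<Longrightarrow> u z \<le> u x"
    using max by (auto simp: is_arg_max_def not_less)
  define C where "C = {(a, s). \<exists>z\<in>orthant. a < u z \<and> p \<bullet> z \<le> s}"
  have conv: "convex C"
  proof (rule convexI)
    fix w w' :: "real \<times> real" and \<theta> \<tau> :: real
    assume w: "w \<in> C" "w' \<in> C" and \<theta>: "0 \<le> \<theta>" "0 \<le> \<tau>" "\<theta> + \<tau> = 1"
    obtain a s z where as: "w = (a, s)" "z \<in> orthant" "a < u z" "p \<bullet> z \<le> s"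
      using w(1) by (auto simp: C_def)
    obtain a' s' z' where as': "w' = (a', s')" "z' \<in> orthant" "a' < u z'" "p \<bullet> z' \<le> s'"
      using w(2) by (auto simp: C_def)
    let ?v = "\<theta> *\<^sub>R z + \<tau> *\<^sub>R z'"
    have "\<theta> * a + \<tau> * a' < \<theta> * u z + \<tau> * u z'"
    proof (cases "\<theta> = 0")
      case True
      with \<theta> as' show ?thesis by simp
    next
      case False
      with \<theta> as(3) as'(3) show ?thesis
        by (intro add_less_le_mono mult_strict_left_mono mult_left_mono) auto
    qed
    also have "\<dots> \<le> u ?v"
    proof -
      have "\<theta> = 1 - \<tau>" "\<tau> \<le> 1" using \<theta> by auto
      then show ?thesis
        using utility_convex_comb[OF u as(2) as'(2), of \<tau>] \<theta> by metis
    qed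
    finally have "\<theta> * a + \<tau> * a' < u ?v" .
    moreover have "p \<bullet> ?v \<le> \<theta> * s + \<tau> * s'"
      using as(4) as'(4) \<theta> by (simp add: inner_add_right add_mono mult_left_mono)
    moreover have "?v \<in> orthant"
      using as(2) as'(2) \<theta> by (intro convexD convex_orthant) auto
    ultimately show "\<theta> *\<^sub>R w + \<tau> *\<^sub>R w' \<in> C"
      using as(1) as'(1) by (auto simp: C_def)
  qed
  have notin: "(u x, b) \<notin> C" using opt by (force simp: C_def)
  have down: "(a', s') \<in> C" if "(a, s) \<in> C" "a' \<le> a" "s \<le> s'" for a s a' s'
    using that unfolding C_def by (blast intro: le_less_trans order_trans)
  have slater: "(-1, 0) \<in> C"
    using u by (auto simp: C_def utility_function_def intro!: bexI[of _ 0])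
  obtain l where l: "0 \<le> l" and sep: "\<And>a s. (a, s) \<in> C \<Longrightarrow> a - l \<bullet> s \<le> u x - l \<bullet> b"
    by (rule lagrange_multiplier[OF conv notin _ slater]) (use down b in auto)
  have "u z \<le> u x + l * (p \<bullet> z - b)" if z: "z \<in> orthant" for z
  proof (rule field_le_epsilon)
    fix e :: real assume "0 < e"
    then have "(u z - e, p \<bullet> z) \<in> C" using z by (auto simp: C_def intro!: bexI[of _ z])
    from sep[OF this] show "u z \<le> u x + l * (p \<bullet> z - b) + e" by (simp add: algebra_simps)
  qed
  with l that show thesis by blast
qed

text \<open>
  An equilibrium bundle is a Gale demand for a budget \<open>u x / l \<ge> b\<close>, or for price \<open>0\<close> when the
  multiplier \<open>l\<close> of the budget constraint vanishes; the latter case needs the \<open>\<Sigma>\<close> condition.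
\<close>

lemma equilibrium_dominates_gale_opt:
  fixes u :: "real ^ 'm::finite \<Rightarrow> real"
  assumes u: "utility_function u" and sgs: "sigma_gale_substitutes u" and b: "0 < b"
    and p: "p \<in> orthant" and max: "is_arg_max u (\<lambda>z. z \<in> orthant \<and> p \<bullet> z \<le> b) x"
  obtains z where "gale_opt u p b z" "z \<le> x"
proof -
  have gs: "gale_substitutes u" using sgs by (simp add: sigma_gale_substitutes_def)
  have x: "x \<in> orthant" "p \<bullet> x \<le> b"
    and opt: "\<And>z. z \<in> orthant \<Longrightarrow> p \<bullet> z \<le> b \<Longrightarrow> u z \<le> u x"
    using max by (auto simp: is_arg_max_def not_less)
  obtain l where l: "0 \<le> l" and lag: "\<And>z. z \<in> orthant \<Longrightarrow> u z \<le> u x + l * (p \<bullet> z - b)"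
    using equilibrium_multiplier[OF u b max] by blast
  obtain v where v: "v \<in> orthant" "0 < u v"
    using u by (auto simp: utility_function_def)
  have xpos: "0 < u x"
  proof -
    have pv: "0 \<le> p \<bullet> v" using p v(1) by (rule inner_orthant_nonneg)
    \<comment> \<open>Scales \<open>v\<close> into the budget set, also when \<open>v\<close> is
      free.\<close>
    define t where "t = b / (b + p \<bullet> v)"
    have t: "0 < t" "t \<le> 1" "t * (p \<bullet> v) \<le> b"
      using b pv by (auto simp: t_def field_simps)
    have "0 < t * u v" using t v by simp
    also have "\<dots> \<le> u (t *\<^sub>R v)" using t by (intro utility_scale u v) auto
    also have "\<dots> \<le> u x" using t v by (intro opt scaleR_in_orthant) auto
    finally show ?thesis .
  qed
  show thesis
  proof (cases "l = 0")
    case True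
    then have "gale_opt u 0 b x"
      using lag by (intro gale_optI_supergradient b x xpos) auto
    moreover from this have "0 \<in> pdom u" using b by (rule gale_opt_in_pdom) simp
    ultimately obtain z where "z \<in> gale_demand u p b" "z \<le> x"
      using sgs b p gale_demand_iff[OF u b] unfolding sigma_gale_substitutes_def by blast
    with that show thesis using gale_demand_iff[OF u b] by blast
  next
    case False
    then have lpos: "0 < l" using l by simp
    \<comment> \<open>The multiplier bound at \<open>x\<close> shows that the whole budget is spent;
      at \<open>0\<close> it gives \<open>l * b \<le> u x\<close>.\<close>
    have "0 \<le> l * (p \<bullet> x - b)" using lag[OF x(1)] by simp
    then have px: "p \<bullet> x = b" using x(2) lpos by (simp add: zero_le_mult_iff)
    have "l * b \<le> u x" using lag[of 0] u by (simp add: utility_function_def)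
    then have bb: "b \<le> u x / l" using lpos by (simp add: field_simps)
    have "gale_opt u p (u x / l) x"
    proof (intro gale_optI_supergradient x xpos)
      fix z :: "real ^ 'm" assume z: "z \<in> orthant"
      \<comment> \<open>The budget \<open>u x / l\<close> makes the slope of the supergradient
        inequality exactly \<open>l\<close>.\<close>
      have "u x * (1 + (p \<bullet> z - p \<bullet> x) / (u x / l)) = u x + l * (p \<bullet> z - b)"
        using xpos lpos px by (simp add: field_simps)
      with lag[OF z] show "u z \<le> u x * (1 + (p \<bullet> z - p \<bullet> x) / (u x / l))" by simp
    qed (use xpos lpos in simp)
    moreover from this have "p \<in> pdom u"
      by (rule gale_opt_in_pdom) (use xpos lpos p in auto)
    ultimately show thesis
      using gale_substitutes_budget[OF u gs b bb] that by blast
  qed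
qed

section \<open>Lowering the supporting prices\<close>

text \<open>\<open>y\<close> is compared with optimal bundles \<open>w\<close> at the new price
  \<open>s\<close>. Each \<open>w k\<close> is at least as good for its agent, but optimality of
  \<open>y\<close> at \<open>q\<close> and the bound on demand in direction \<open>q - r\<close>
  make them no better in total; so all are equally good.\<close>

lemma gale_prices_along_segment:
  fixes u :: "'a \<Rightarrow> real ^ 'm::finite \<Rightarrow> real" and p q r :: "real ^ 'm"
  assumes fin: "finite A" and b: "\<And>i. i \<in> A \<Longrightarrow> 0 < b i"
    and ut: "\<And>i. i \<in> A \<Longrightarrow> utility_function (u i)"
    and gs: "\<And>i. i \<in> A \<Longrightarrow> gale_substitutes (u i)"
    and p: "p \<in> orthant" and q: "q \<in> orthant"
    and z: "\<And>i. i \<in> A \<Longrightarrow> gale_opt (u i) p (b i) (z i)" and zle: "(\<Sum>i\<in>A. z i) \<le> 1"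
    and y: "\<And>i. i \<in> A \<Longrightarrow> gale_opt (u i) q (b i) (y i)" and yle: "(\<Sum>i\<in>A. y i) \<le> 1"
    and slack: "q \<bullet> (\<Sum>i\<in>A. y i) = q \<bullet> 1"
    and r: "r = (\<chi> j. min (q $ j) (p $ j))" and t: "0 < t" "t \<le> 1" and i: "i \<in> A"
  shows "gale_opt (u i) (r + t *\<^sub>R (q - r)) (b i) (y i)"
proof -
  define d where "d = q - r"
  define s where "s = r + t *\<^sub>R d"
  define p' where "p' = p + t *\<^sub>R d"
  have d: "d \<in> orthant" by (auto simp: d_def r orthant_iff)
  have so: "s \<in> orthant"
    using t p q d by (auto simp: s_def r orthant_iff)
  have sp': "s \<le> p'" by (auto simp: s_def p'_def r less_eq_vec_def)
  have pp': "p \<le> p'" using d t by (auto simp: p'_def less_eq_vec_def orthant_iff)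
  have "(1 - t) *\<^sub>R r \<in> orthant"
    using t p q by (intro scaleR_in_orthant) (auto simp: r orthant_iff)
  moreover have "s = t *\<^sub>R q + (1 - t) *\<^sub>R r" by (simp add: s_def d_def algebra_simps)
  \<comment> \<open>This keeps \<open>s\<close> in the price domains; the endpoint \<open>r\<close> itself may lie outside.\<close>
  ultimately have tqs: "t *\<^sub>R q \<le> s" by (simp add: orthant_def)
  have "\<exists>w. gale_opt (u k) s (b k) w \<and> d \<bullet> w \<le> d \<bullet> z k" if k: "k \<in> A" for k
  proof -
    have sdom: "s \<in> pdom (u k)"
      using gale_opt_in_pdom[OF y b q] k t tqs by (blast intro: pdom_upward pdom_scaleR)
    have p'dom: "p' \<in> pdom (u k)" using sdom sp' by (rule pdom_upward)
    obtain v where v: "gale_opt (u k) p' (b k) v"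
      using gale_opt_exists[OF ut gs b p'dom] k by blast
    obtain w where w: "gale_opt (u k) s (b k) w" "\<And>j. s $ j = p' $ j \<Longrightarrow> w $ j \<le> v $ j"
      using gale_substitutes_price[OF ut gs b p'dom sdom sp' v] k by blast
    \<comment> \<open>Goods with \<open>q $ j < p $ j\<close> have \<open>d $ j = 0\<close>. On all
      others \<open>r\<close> equals \<open>p\<close>, so \<open>s\<close> and \<open>p'\<close>
      agree there and the substitutes property applies.\<close>
    have "d $ j * w $ j \<le> d $ j * v $ j" for j
    proof (cases "p $ j \<le> q $ j")
      case True
      then have "s $ j = p' $ j" by (simp add: s_def p'_def r)
      then show ?thesis using w(2) d by (auto simp: orthant_iff intro: mult_left_mono)
    next
      case False
      then show ?thesis by (simp add: d_def r)
    qed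
    then have "d \<bullet> w \<le> d \<bullet> v" by (auto simp: inner_vec_def intro: sum_mono)
    also have "d \<bullet> v \<le> d \<bullet> z k"
    proof -
      \<comment> \<open>Optimality of \<open>z k\<close> at \<open>p\<close> and of \<open>v\<close>
        at \<open>p'\<close> add up to the law of demand in direction \<open>d\<close>.\<close>
      have "b k * ln (u k (z k)) - p' \<bullet> z k \<le> b k * ln (u k v) - p' \<bullet> v"
        "b k * ln (u k v) - p \<bullet> v \<le> b k * ln (u k (z k)) - p \<bullet> z k"
        using v z[OF k] by (auto simp: gale_opt_def)
      then have "t * (d \<bullet> v) \<le> t * (d \<bullet> z k)"
        by (simp add: p'_def inner_add_left)
      then show ?thesis using t by simp
    qed
    finally show ?thesis using w(1) by blast
  qed
  then obtain w where w: "\<And>k. k \<in> A \<Longrightarrow> gale_opt (u k) s (b k) (w k)"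
    "\<And>k. k \<in> A \<Longrightarrow> d \<bullet> w k \<le> d \<bullet> z k"
    by metis
  let ?V = "\<lambda>x k. b k * ln (u k (x k))"
  have sumw: "(\<Sum>k\<in>A. d \<bullet> w k) \<le> d \<bullet> 1"
  proof -
    have "(\<Sum>k\<in>A. d \<bullet> w k) \<le> (\<Sum>k\<in>A. d \<bullet> z k)" using w(2) by (intro sum_mono)
    also have "\<dots> = d \<bullet> (\<Sum>k\<in>A. z k)" by (simp add: inner_sum_right)
    also have "\<dots> \<le> d \<bullet> 1" using d zle by (rule inner_orthant_mono_right)
    finally show ?thesis .
  qed
  have sq: "s \<bullet> x = q \<bullet> x - (1 - t) * (d \<bullet> x)" for x
    by (simp add: s_def d_def inner_diff_left inner_add_left algebra_simps)
  have le: "?V y k - s \<bullet> y k \<le> ?V w k - s \<bullet> w k" if "k \<in> A" for k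
    using w(1)[OF that] y[OF that] by (auto simp: gale_opt_def)
  \<comment> \<open>At \<open>q\<close>, \<open>w\<close> is no better than \<open>y\<close>. The
    change to \<open>s\<close> refunds \<open>w\<close> at most
    \<open>(1 - t) * (d \<bullet> 1)\<close> in total, and \<open>y\<close> at least that
    much.\<close>
  have "(\<Sum>k\<in>A. ?V w k - s \<bullet> w k) \<le> (\<Sum>k\<in>A. ?V y k - s \<bullet> y k)"
  proof -
    have "(\<Sum>k\<in>A. ?V w k - q \<bullet> w k) \<le> (\<Sum>k\<in>A. ?V y k - q \<bullet> y k)"
      using w(1) y by (intro sum_mono) (auto simp: gale_opt_def)
    also have "\<dots> = (\<Sum>k\<in>A. ?V y k) - q \<bullet> 1"
      using slack by (simp add: sum_subtractf inner_sum_right)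
    finally have "(\<Sum>k\<in>A. ?V w k - q \<bullet> w k) \<le> (\<Sum>k\<in>A. ?V y k) - q \<bullet> 1" .
    moreover have "(\<Sum>k\<in>A. ?V w k - s \<bullet> w k)
        = (\<Sum>k\<in>A. ?V w k - q \<bullet> w k) + (1 - t) * (\<Sum>k\<in>A. d \<bullet> w k)"
      by (simp add: sq sum_subtractf sum.distrib sum_distrib_left)
    moreover have "(1 - t) * (\<Sum>k\<in>A. d \<bullet> w k) \<le> (1 - t) * (d \<bullet> 1)"
      using sumw t by (intro mult_left_mono) auto
    moreover have "s \<bullet> 1 = q \<bullet> 1 - (1 - t) * (d \<bullet> 1)" by (rule sq)
    moreover have "s \<bullet> (\<Sum>k\<in>A. y k) \<le> s \<bullet> 1" using so yle by (rule inner_orthant_mono_right)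
    ultimately show ?thesis by (simp add: sum_subtractf inner_sum_right)
  qed
  \<comment> \<open>All gaps are nonnegative, so a nonpositive sum makes the gap of \<open>i\<close>
    vanish.\<close>
  then have "(\<Sum>k\<in>A. (?V w k - s \<bullet> w k) - (?V y k - s \<bullet> y k)) \<le> 0"
    by (simp add: sum_subtractf)
  moreover have nn: "0 \<le> (?V w k - s \<bullet> w k) - (?V y k - s \<bullet> y k)" if "k \<in> A" for k
    using le[OF that] by simp
  ultimately have "(?V w i - s \<bullet> w i) - (?V y i - s \<bullet> y i) \<le> 0"
    using member_le_sum[OF i nn fin] by (meson DiffD1 order_trans)
  with w(1)[OF i] y[OF i] show ?thesis
    by (fastforce simp: gale_opt_def s_def d_def)
qed

section \<open>The factor two\<close>

theorem theorem1p3: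
  fixes A :: "'a set"
    and b :: "'a \<Rightarrow> real"
    and u :: "'a \<Rightarrow> real ^ 'm::finite \<Rightarrow> real"
    and x y :: "'a \<Rightarrow> real ^ 'm"
    and p :: "real ^ 'm"
  assumes "fisher_market A b u"
    and "\<And>i. i \<in> A \<Longrightarrow> sigma_gale_substitutes (u i)"
    and "competitive_equilibrium A b u x p"
    and "nash_welfare_maximizing A b u y"
  shows "\<forall>i\<in>A. u i (y i) \<ge> 1 / 2 * u i (x i)"
proof
  fix i assume i: "i \<in> A"
  then have A: "A \<noteq> {}" by auto
  have fin: "finite A" and b: "\<And>i. i \<in> A \<Longrightarrow> 0 < b i"
    and ut: "\<And>i. i \<in> A \<Longrightarrow> utility_function (u i)"
    using assms(1) by (auto simp: fisher_market_def)
  have gs: "\<And>i. i \<in> A \<Longrightarrow> gale_substitutes (u i)"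
    using assms(2) by (simp add: sigma_gale_substitutes_def)
  have p: "p \<in> orthant"
    and xmax: "\<And>i. i \<in> A \<Longrightarrow> is_arg_max (u i) (\<lambda>z. z \<in> orthant \<and> p \<bullet> z \<le> b i) (x i)"
    and xle: "(\<Sum>i\<in>A. x i) \<le> 1"
    using assms(3) by (auto simp: competitive_equilibrium_def feasible_allocation_def less_eq_vec_def)
  have yle: "(\<Sum>i\<in>A. y i) \<le> 1"
    using assms(4)
    by (simp add: nash_welfare_maximizing_def is_arg_max_def feasible_allocation_def less_eq_vec_def)
  obtain q where q: "q \<in> orthant" "\<And>i. i \<in> A \<Longrightarrow> gale_opt (u i) q (b i) (y i)"
    "q \<bullet> (\<Sum>i\<in>A. y i) = q \<bullet> 1"
    using nash_supporting_prices[OF assms(1) A assms(4)] by blast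
  have "\<exists>z. gale_opt (u i) p (b i) z \<and> z \<le> x i" if "i \<in> A" for i
    using equilibrium_dominates_gale_opt[OF ut assms(2) b p xmax] that by metis
  then obtain z where z: "\<And>i. i \<in> A \<Longrightarrow> gale_opt (u i) p (b i) (z i)" "\<And>i. i \<in> A \<Longrightarrow> z i \<le> x i"
    by metis
  have zle: "(\<Sum>i\<in>A. z i) \<le> 1"
    using sum_mono[of A z x] z(2) xle by (blast intro: order_trans)
  define r :: "real ^ 'm" where "r = (\<chi> j. min (q $ j) (p $ j))"
  have xo: "x i \<in> orthant" and px: "p \<bullet> x i \<le> b i"
    using xmax[OF i] by (auto simp: is_arg_max_def)
  have yo: "y i \<in> orthant" and ypos: "0 < u i (y i)"
    using q(2)[OF i] by (auto simp: gale_opt_def)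
  have "u i (x i) \<le> u i (y i) * (1 + ((r + t *\<^sub>R (q - r)) \<bullet> x i - (r + t *\<^sub>R (q - r)) \<bullet> y i) / b i)"
    if t: "0 < t" "t < 1" for t
    using gale_opt_supergradient[OF ut[OF i] b[OF i] _ xo]
      gale_prices_along_segment[OF fin b ut gs p q(1) z(1) zle q(2) yle q(3) r_def _ _ i] t by simp
  then have ev: "\<forall>\<^sub>F t in at_right 0. u i (x i) \<le>
      u i (y i) * (1 + ((r + t *\<^sub>R (q - r)) \<bullet> x i - (r + t *\<^sub>R (q - r)) \<bullet> y i) / b i)"
    unfolding eventually_at_right_field by (intro exI[of _ "1::real"]) auto
  \<comment> \<open>Only the supergradient inequality, continuous in the price, is carried to
    \<open>r\<close>; optimality at \<open>r\<close> is not claimed.\<close>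
  have "((\<lambda>t. u i (y i) * (1 + ((r + t *\<^sub>R (q - r)) \<bullet> x i - (r + t *\<^sub>R (q - r)) \<bullet> y i) / b i)) \<longlongrightarrow>
      u i (y i) * (1 + ((r + 0 *\<^sub>R (q - r)) \<bullet> x i - (r + 0 *\<^sub>R (q - r)) \<bullet> y i) / b i)) (at_right 0)"
    using b[OF i] by (intro tendsto_intros) auto
  from tendsto_lowerbound[OF this ev]
  have "u i (x i) \<le> u i (y i) * (1 + (r \<bullet> x i - r \<bullet> y i) / b i)" by simp
  also have "\<dots> \<le> u i (y i) * 2"
  proof (rule mult_left_mono)
    \<comment> \<open>\<open>r \<le> p\<close> bounds the cost of \<open>x i\<close> at
      \<open>r\<close> by the budget; divided by \<open>b i\<close> this is the second unit of the
      factor \<open>2\<close>.\<close>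
    have "r \<bullet> x i \<le> p \<bullet> x i"
      using xo by (intro inner_orthant_mono) (auto simp: r_def less_eq_vec_def)
    moreover have "0 \<le> r \<bullet> y i"
      using p q(1) yo by (intro inner_orthant_nonneg) (auto simp: r_def orthant_iff)
    ultimately have "r \<bullet> x i - r \<bullet> y i \<le> b i" using px by linarith
    then show "1 + (r \<bullet> x i - r \<bullet> y i) / b i \<le> 2" using b[OF i] by simp
  qed (use ypos in simp)
  finally show "1 / 2 * u i (x i) \<le> u i (y i)" by simp
qed

end
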